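(* Let $X$ and $Y$ be Banach spaces. Suppose that the norm of $X$ is uniformly micro-semitransitive (in particular, this covers the case in which the norm of $X$ is micro-transitive) and that the pair $(X,Y)$ has the Bishop-Phelps-Bollobás property. Then the pair $(X,Y)$ has the pointwise Bishop-Phelps-Bollobás property.
   Context: Banach spaces are over $\mathbb{K}=\mathbb{R}$ or $\mathbb{C}$. $S_X$ is the unit sphere of $X$, $\mathcal{L}(X,Y)$ is the space of bounded linear operators from $X$ to $Y$ with the operator norm, $\mathcal{L}(X)=\mathcal{L}(X,X)$, and $\mathrm{Id}$ is the identity operator. The norm of $X$ is micro-transitive if the group $G$ of surjective linear isometries of $X$ (with the operator-norm topology) acts micro-transitively on $S_X$: for every $x\in S_X$ and every neighborhood $U$ of $\mathrm{Id}$ in $G$, the set $Ux=\{Tx : T\in U\}$ is a neighborhood of $x$ in $S_X$. The norm of $X$ is uniformly micro-semitransitive if there is a function $\beta:(0,2)\to(0,\infty)$ such that whenever $\varepsilon\in(0,2)$ and $x,y\in S_X$ satisfy $\|x-y\|<\beta(\varepsilon)$, there is $T\in\mathcal{L}(X)$ with $\|T\|=1$, $Tx=y$ and $\|T-\mathrm{Id}\|<\varepsilon$. A pair $(X,Y)$ of Banach spaces has the Bishop-Phelps-Bollobás property if for every $\varepsilon>0$ there is $\eta(\varepsilon)>0$ such that whenever $T\in\mathcal{L}(X,Y)$ with $\|T\|=1$ and $x_0\in S_X$ satisfy $\|Tx_0\|>1-\eta(\varepsilon)$, there are $S\in\mathcal{L}(X,Y)$ with $\|S\|=1$ and $x\in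 S_X$ such that $\|Sx\|=1$, $\|x_0-x\|<\varepsilon$ and $\|S-T\|<\varepsilon$. A pair $(X,Y)$ has the pointwise Bishop-Phelps-Bollobás property if for every $\varepsilon>0$ there is $\tilde\eta(\varepsilon)>0$ such that whenever $T\in\mathcal{L}(X,Y)$ with $\|T\|=1$ and $x_0\in S_X$ satisfy $\|Tx_0\|>1-\tilde\eta(\varepsilon)$, there is $S\in\mathcal{L}(X,Y)$ with $\|S\|=1$ such that $\|Sx_0\|=1$ and $\|S-T\|<\varepsilon$. *)

theory Defs
  imports "HOL-Analysis.Analysis"
begin

text \<open>
  A Banach space over \<open>\<real>\<close> or \<open>\<complex>\<close> is a type of class \<^class>\<open>banach\<close> with a scalar multiplication
  \<open>scale\<close> by the scalar type \<open>'k\<close> that extends the real one and for which the norm is homogeneous.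
  The spaces over \<^typ>\<open>real\<close> and \<^typ>\<open>complex\<close> are the instances \<open>'k = real\<close> (where
  \<open>scale = scaleR\<close>) and \<open>'k = complex\<close>. The class \<^class>\<open>real_normed_field\<close> covers both, and by
  the Gelfand-Mazur theorem it contains no further fields up to isometric isomorphism.
\<close>

locale banach_over = vector_space scale
  for scale :: "'k::real_normed_field \<Rightarrow> 'a::banach \<Rightarrow> 'a" +
  assumes scale_of_real: "scale (of_real r) x = r *\<^sub>R x"
    and norm_scale: "norm (scale c x) = norm c * norm x"

text \<open>
  \<open>\<L>(X, Y)\<close>. The elements of \<open>'a \<Rightarrow>\<^sub>L 'b\<close> are the bounded real-linear maps, normed by the operator
  norm; over the complex scalars one has to keep only those that are complex-linear.
\<close>

definition bounded_ops ::
  "('k::real_normed_field \<Rightarrow> 'a::banach \<Rightarrow> 'a) \<Rightarrow> ('k \<Rightarrow> 'b::banach \<Rightarrow> 'b) \<Rightarrow> ('a \<Rightarrow>\<^sub>L 'b) set"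
  where "bounded_ops sX sY = {T. Vector_Spaces.linear sX sY (blinfun_apply T)}"

definition isometry_group ::
  "('k::real_normed_field \<Rightarrow> 'a::banach \<Rightarrow> 'a) \<Rightarrow> ('a \<Rightarrow>\<^sub>L 'a) set"
  where "isometry_group sX =
    {T \<in> bounded_ops sX sX. surj (blinfun_apply T) \<and> (\<forall>x. norm (blinfun_apply T x) = norm x)}"

definition nbhd_in :: "'a::topological_space set \<Rightarrow> 'a \<Rightarrow> 'a set \<Rightarrow> bool"
  where "nbhd_in S x U \<longleftrightarrow> U \<subseteq> S \<and> (\<exists>V. openin (top_of_set S) V \<and> x \<in> V \<and> V \<subseteq> U)"

definition micro_transitive :: "('k::real_normed_field \<Rightarrow> 'a::banach \<Rightarrow> 'a) \<Rightarrow> bool"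
  where "micro_transitive sX \<longleftrightarrow>
    (\<forall>x \<in> sphere 0 1. \<forall>U. nbhd_in (isometry_group sX) id_blinfun U \<longrightarrow>
       nbhd_in (sphere 0 1) x ((\<lambda>T. blinfun_apply T x) ` U))"

definition uniformly_micro_semitransitive ::
  "('k::real_normed_field \<Rightarrow> 'a::banach \<Rightarrow> 'a) \<Rightarrow> bool"
  where "uniformly_micro_semitransitive sX \<longleftrightarrow>
    (\<exists>\<beta> :: real \<Rightarrow> real. (\<forall>\<epsilon>\<in>{0<..<2}. \<beta> \<epsilon> > 0) \<and>
       (\<forall>\<epsilon>\<in>{0<..<2}. \<forall>x \<in> sphere 0 1. \<forall>y \<in> sphere 0 1. norm (x - y) < \<beta> \<epsilon> \<longrightarrow>
          (\<exists>T \<in> bounded_ops sX sX.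
             norm T = 1 \<and> blinfun_apply T x = y \<and> norm (T - id_blinfun) < \<epsilon>)))"

definition BPB_property ::
  "('k::real_normed_field \<Rightarrow> 'a::banach \<Rightarrow> 'a) \<Rightarrow> ('k \<Rightarrow> 'b::banach \<Rightarrow> 'b) \<Rightarrow> bool"
  where "BPB_property sX sY \<longleftrightarrow>
    (\<forall>\<epsilon>>0. \<exists>\<eta>>0. \<forall>T \<in> bounded_ops sX sY. \<forall>x0 \<in> sphere 0 1.
       norm T = 1 \<and> norm (blinfun_apply T x0) > 1 - \<eta> \<longrightarrow>
       (\<exists>S \<in> bounded_ops sX sY. \<exists>x \<in> sphere 0 1.
          norm S = 1 \<and> norm (blinfun_apply S x) = 1 \<and> norm (x0 - x) < \<epsilon> \<and> norm (S - T) < \<epsilon>))"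

definition pointwise_BPB_property ::
  "('k::real_normed_field \<Rightarrow> 'a::banach \<Rightarrow> 'a) \<Rightarrow> ('k \<Rightarrow> 'b::banach \<Rightarrow> 'b) \<Rightarrow> bool"
  where "pointwise_BPB_property sX sY \<longleftrightarrow>
    (\<forall>\<epsilon>>0. \<exists>\<eta>>0. \<forall>T \<in> bounded_ops sX sY. \<forall>x0 \<in> sphere 0 1.
       norm T = 1 \<and> norm (blinfun_apply T x0) > 1 - \<eta> \<longrightarrow>
       (\<exists>S \<in> bounded_ops sX sY.
          norm S = 1 \<and> norm (blinfun_apply S x0) = 1 \<and> norm (S - T) < \<epsilon>))"

end

theory Submission
  imports Defs
begin

text \<open>
  If \<open>S\<close> attains its norm at a point \<open>x\<close> near \<open>x\<^sub>0\<close> and \<open>R x\<^sub>0 = x\<close> with \<open>R\<close> of norm one close to the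
  identity, then \<open>S \<circ> R\<close> attains its norm at \<open>x\<^sub>0\<close> and is close to \<open>S\<close>. For the second claim,
  micro-transitivity makes the orbits of the isometry group open in the sphere, so any two points
  joined by a path in the sphere lie in the same orbit; antipodal points are exchanged by \<open>- Id\<close>.
  Hence the action is transitive. Since conjugation by an isometry preserves the distance to the
  identity, a radius that works at one point of the sphere works at all of them.
\<close>

section \<open>The group of surjective linear isometries\<close>

lemma bounded_ops_compose:
  assumes "S \<in> bounded_ops sY sZ" "T \<in> bounded_ops sX sY"
  shows "S o\<^sub>L T \<in> bounded_ops sX sZ"
  using assms Vector_Spaces.linear_compose[of sX sY _ sZ]
  by (auto simp: bounded_ops_def o_def blinfun_compose.rep_eq)

text \<open>The point \<open>x\<close> of the sphere rules out the zero space, where the identity is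
  an isometry of norm 0.\<close>

lemma isometry_norm:
  fixes T :: "'a::banach \<Rightarrow>\<^sub>L 'a" and x :: 'a
  assumes "T \<in> isometry_group sX" "x \<in> sphere 0 1"
  shows "norm T = 1"
proof (rule antisym)
  show "norm T \<le> 1"
    using assms(1) by (intro norm_blinfun_bound) (auto simp: isometry_group_def)
  show "1 \<le> norm T"
    using norm_blinfun[of T x] assms by (auto simp: isometry_group_def)
qed

lemma isometry_compose:
  assumes "S \<in> isometry_group sX" "T \<in> isometry_group sX"
  shows "S o\<^sub>L T \<in> isometry_group sX"
  using assms bounded_ops_compose[of S sX sX T sX] comp_surj[of T S]
  by (auto simp: isometry_group_def o_def blinfun_compose.rep_eq)

lemma id_isometry:
  assumes "banach_over sX"
  shows "id_blinfun \<in> isometry_group sX"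
proof -
  interpret banach_over sX by fact
  show ?thesis
    using linear_id by (auto simp: isometry_group_def bounded_ops_def id_def)
qed

lemma uminus_id_isometry:
  assumes "banach_over sX"
  shows "- id_blinfun \<in> isometry_group sX"
proof -
  interpret banach_over sX by fact
  have "blinfun_apply (- id_blinfun) = (\<lambda>x::'b. - x)"
    by (auto simp: uminus_blinfun.rep_eq)
  then show ?thesis
    using linear_uminus by (auto simp: isometry_group_def bounded_ops_def surj_def) (metis minus_minus)
qed

lemma isometry_inverse:
  assumes "banach_over sX" "T \<in> isometry_group sX"
  obtains T' where "T' \<in> isometry_group sX" "T' o\<^sub>L T = id_blinfun" "T o\<^sub>L T' = id_blinfun"
proof -
  interpret banach_over sX by fact
  interpret T: Vector_Spaces.linear sX sX T
    using assms(2) by (simp add: isometry_group_def bounded_ops_def)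
  have nT: "norm (blinfun_apply T x) = norm x" for x
    using assms(2) by (simp add: isometry_group_def)
  have surjT: "surj (blinfun_apply T)"
    using assms(2) by (simp add: isometry_group_def)
  have injT: "inj (blinfun_apply T)"
  proof (rule injI)
    fix x y assume "blinfun_apply T x = blinfun_apply T y"
    then have "norm (blinfun_apply T (x - y)) = 0" by (simp add: blinfun.diff_right)
    then show "x = y" by (simp add: nT)
  qed
  define g where "g = inv (blinfun_apply T)"
  have Tg: "blinfun_apply T (g y) = y" for y
    by (simp add: g_def surj_f_inv_f surjT)
  have gT: "g (blinfun_apply T x) = x" for x
    by (simp add: g_def injT)
  have ng: "norm (g y) = norm y" for y
    using nT[of "g y"] by (simp add: Tg)
  have bl: "bounded_linear g"
  proof (rule bounded_linear_intro[where K = 1])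
    fix x y and r :: real
    show "g (x + y) = g x + g y"
      by (rule injD[OF injT]) (simp add: Tg blinfun.add_right)
    show "g (r *\<^sub>R x) = r *\<^sub>R g x"
      by (rule injD[OF injT]) (simp add: Tg blinfun.scaleR_right)
    show "norm (g x) \<le> norm x * 1" by (simp add: ng)
  qed
  \<comment> \<open>\<open>bl\<close> only yields real linearity; membership in
    \<open>bounded_ops\<close> asks for linearity over the scalars of \<open>sX\<close>. As before,
    it is checked after applying the injective map \<open>T\<close>.\<close>
  have lin: "Vector_Spaces.linear sX sX g"
  proof (intro Vector_Spaces.linear.intro module_hom.intro module_hom_axioms.intro)
    show "g (x + y) = g x + g y" for x y
      by (rule injD[OF injT]) (simp add: Tg blinfun.add_right)
    show "g (sX c x) = sX c (g x)" for c x
      by (rule injD[OF injT]) (simp add: Tg T.scale)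
  qed unfold_locales
  show ?thesis
  proof
    show "Blinfun g \<in> isometry_group sX"
      using lin ng gT by (auto simp: isometry_group_def bounded_ops_def bounded_linear_Blinfun_apply[OF bl] surj_def)
        metis
    show "Blinfun g o\<^sub>L T = id_blinfun" "T o\<^sub>L Blinfun g = id_blinfun"
      by (auto intro!: blinfun_eqI simp: bounded_linear_Blinfun_apply[OF bl] gT Tg)
  qed
qed

section \<open>From micro-transitivity to uniform micro-semitransitivity\<close>

lemma micro_transitive_metric:
  assumes "banach_over sX" "micro_transitive sX" "x \<in> sphere 0 1" "\<epsilon> > 0"
  obtains \<delta> where "\<delta> > 0"
    "\<And>y. y \<in> sphere 0 1 \<Longrightarrow> norm (x - y) < \<delta> \<Longrightarrow>
       \<exists>T \<in> isometry_group sX. blinfun_apply T x = y \<and> norm (T - id_blinfun) < \<epsilon>"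
proof -
  let ?U = "isometry_group sX \<inter> ball id_blinfun \<epsilon>"
  have "nbhd_in (isometry_group sX) id_blinfun ?U"
    unfolding nbhd_in_def using id_isometry[OF assms(1)] assms(4)
    by (auto intro!: exI[of _ ?U] openin_open_Int)
  then have "nbhd_in (sphere 0 1) x ((\<lambda>T. blinfun_apply T x) ` ?U)"
    using assms(2,3) by (simp add: micro_transitive_def)
  then obtain V where V: "openin (top_of_set (sphere 0 1)) V" "x \<in> V"
    "V \<subseteq> (\<lambda>T. blinfun_apply T x) ` ?U"
    unfolding nbhd_in_def by blast
  \<comment> \<open>This radius depends on \<open>x\<close> as well as on \<open>\<epsilon>\<close>;
    uniformity in \<open>x\<close> has to come from transitivity.\<close>
  then obtain \<delta> where "\<delta> > 0" and \<delta>: "ball x \<delta> \<inter> sphere 0 1 \<subseteq> V"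
    by (meson openin_contains_ball)
  show ?thesis
  proof (rule that[OF \<open>\<delta> > 0\<close>])
    fix y :: 'b assume "y \<in> sphere 0 1" "norm (x - y) < \<delta>"
    then have "y \<in> V" using \<delta> by (auto simp: dist_norm)
    then show "\<exists>T \<in> isometry_group sX. blinfun_apply T x = y \<and> norm (T - id_blinfun) < \<epsilon>"
      using V(3) by (force simp: dist_norm norm_minus_commute)
  qed
qed

lemma micro_transitive_imp_transitive:
  assumes "banach_over sX" "micro_transitive sX" and x: "x \<in> sphere 0 1" and y: "y \<in> sphere 0 1"
  obtains T where "T \<in> isometry_group sX" "blinfun_apply T x = y"
\<comment> \<open>The segment from \<open>x\<close> to \<open>y\<close> passes through 0 only if
  \<open>y = - x\<close>; otherwise it can be normalised to a path \<open>p\<close> in the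
  sphere.\<close>
proof (cases "y = - x")
  case True
  then show ?thesis
    using that[OF uminus_id_isometry[OF assms(1)]] by (simp add: uminus_blinfun.rep_eq)
next
  case False
  define h where "h t = (1 - t) *\<^sub>R x + t *\<^sub>R y" for t :: real
  have h0: "h t \<noteq> 0" if "t \<in> {0..1}" for t
  proof
    assume "h t = 0"
    then have eq: "t *\<^sub>R y = - ((1 - t) *\<^sub>R x)"
      by (simp add: h_def eq_neg_iff_add_eq_0 add.commute)
    \<comment> \<open>Comparing norms of unit vectors gives \<open>t = 1 - t\<close>, so 0 could
      only be the midpoint.\<close>
    then have "norm (t *\<^sub>R y) = norm ((1 - t) *\<^sub>R x)" by simp
    then have "t = 1/2" using that x y by simp
    then have "(1/2::real) *\<^sub>R y = (1/2) *\<^sub>R (- x)" using eq by (simp only:) simp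
    then show False using False by (simp del: scaleR_minus_right)
  qed
  define p where "p t = h t /\<^sub>R norm (h t)" for t
  define C where "C = p ` {0..1}"
  have "continuous_on {0..1} p"
    unfolding p_def using h0 by (auto simp: h_def intro!: continuous_intros)
  then have "connected C"
    unfolding C_def by (rule connected_continuous_image) simp
  have CS: "C \<subseteq> sphere 0 1"
    using h0 by (auto simp: C_def p_def)
  have "p 0 = x" "p 1 = y" using x y by (auto simp: p_def h_def)
  then have "x \<in> C" "y \<in> C" by (auto simp: C_def image_iff intro: bexI[of _ 0] bexI[of _ 1])
  define R where "R a b \<longleftrightarrow> (\<exists>T \<in> isometry_group sX. blinfun_apply T a = b)" for a b
  have "R x y"
    using \<open>connected C\<close> \<open>x \<in> C\<close> \<open>y \<in> C\<close>
  \<comment> \<open>Lying in the same orbit is symmetric by inverses and transitive by composition,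
    and on \<open>C\<close> it holds locally; a connected set then meets only one orbit.\<close>
  proof (rule connected_equivalence_relation)
    fix a b assume "R a b"
    then obtain T where T: "T \<in> isometry_group sX" "blinfun_apply T a = b" by (auto simp: R_def)
    obtain T' where T': "T' \<in> isometry_group sX" "T' o\<^sub>L T = id_blinfun"
      using isometry_inverse[OF assms(1) T(1)] .
    have "blinfun_apply T' b = blinfun_apply (T' o\<^sub>L T) a" by (simp add: T(2))
    then show "R b a" using T' by (auto simp: R_def)
  next
    fix a b c assume "R a b" "R b c"
    then show "R a c"
      unfolding R_def by (metis isometry_compose blinfun_apply_blinfun_compose)
  next
    fix a assume "a \<in> C"
    then have "a \<in> sphere 0 1" using CS by blast
    \<comment> \<open>The bound 1 on the distance to the identity is arbitrary: only the existence
      of an isometry taking \<open>a\<close> to \<open>b\<close> matters.\<close>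
    then obtain \<delta> where \<delta>: "\<delta> > 0" "\<And>b. b \<in> sphere 0 1 \<Longrightarrow> norm (a - b) < \<delta> \<Longrightarrow> R a b"
      using micro_transitive_metric[OF assms(1,2) _ zero_less_one] unfolding R_def by metis
    show "\<exists>T. openin (top_of_set C) T \<and> a \<in> T \<and> (\<forall>b\<in>T. R a b)"
      using \<delta> CS \<open>a \<in> C\<close>
      by (intro exI[of _ "C \<inter> ball a \<delta>"]) (auto simp: dist_norm openin_open_Int subset_iff)
  qed
  then show ?thesis using that by (auto simp: R_def)
qed

lemma micro_transitive_imp_uniformly_micro_semitransitive:
  assumes "banach_over sX" "micro_transitive sX"
  shows "uniformly_micro_semitransitive sX"
proof -
  have "\<exists>\<delta>>0. \<forall>x \<in> sphere 0 1. \<forall>y \<in> sphere 0 1. norm (x - y) < \<delta> \<longrightarrow>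
      (\<exists>T \<in> bounded_ops sX sX. norm T = 1 \<and> blinfun_apply T x = y \<and> norm (T - id_blinfun) < \<epsilon>)"
    if \<epsilon>: "\<epsilon> > 0" for \<epsilon>
  \<comment> \<open>In the zero space the claim is vacuous; otherwise the radius at one base point
    \<open>x0\<close> will serve for all points.\<close>
  proof (cases "sphere (0::'b) 1 = {}")
    case True
    then show ?thesis by (metis empty_iff zero_less_one)
  next
    case False
    then obtain x0 :: 'b where x0: "x0 \<in> sphere 0 1" by blast
    obtain \<delta> where \<delta>: "\<delta> > 0" "\<And>y. y \<in> sphere 0 1 \<Longrightarrow> norm (x0 - y) < \<delta> \<Longrightarrow>
       \<exists>T \<in> isometry_group sX. blinfun_apply T x0 = y \<and> norm (T - id_blinfun) < \<epsilon>"
      using micro_transitive_metric[OF assms x0 \<epsilon>] by blast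
    have "\<exists>T \<in> bounded_ops sX sX. norm T = 1 \<and> blinfun_apply T x = y \<and> norm (T - id_blinfun) < \<epsilon>"
      if x: "x \<in> sphere 0 1" and y: "y \<in> sphere 0 1" and xy: "norm (x - y) < \<delta>" for x y
    proof -
      obtain R where R: "R \<in> isometry_group sX" "blinfun_apply R x0 = x"
        using micro_transitive_imp_transitive[OF assms x0 x] .
      obtain R' where R': "R' \<in> isometry_group sX" "R' o\<^sub>L R = id_blinfun" "R o\<^sub>L R' = id_blinfun"
        using isometry_inverse[OF assms(1) R(1)] .
      have R'R: "blinfun_apply R' (blinfun_apply R z) = z" for z
        using R'(2) by (metis blinfun_apply_blinfun_compose blinfun_apply_id_blinfun id_apply)
      have RR': "blinfun_apply R (blinfun_apply R' z) = z" for z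
        using R'(3) by (metis blinfun_apply_blinfun_compose blinfun_apply_id_blinfun id_apply)
      have n: "norm (blinfun_apply R' z) = norm z" for z
        using R'(1) by (simp add: isometry_group_def)
      have "x0 - blinfun_apply R' y = blinfun_apply R' (x - y)"
        using R'R[of x0] R(2) by (simp add: blinfun.diff_right)
      then have "norm (x0 - blinfun_apply R' y) < \<delta>" by (simp add: n xy)
      then obtain T where T: "T \<in> isometry_group sX" "blinfun_apply T x0 = blinfun_apply R' y"
        "norm (T - id_blinfun) < \<epsilon>"
        using \<delta>(2)[of "blinfun_apply R' y"] y by (auto simp: n)
      \<comment> \<open>Conjugation carries the situation at \<open>x0\<close> back to
        \<open>x\<close>: \<open>R'\<close> sends \<open>x\<close> to \<open>x0\<close>,
        \<open>T\<close> sends \<open>x0\<close> to \<open>R' y\<close>, and \<open>R\<close> sends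
        that to \<open>y\<close>.\<close>
      define Q where "Q = R o\<^sub>L T o\<^sub>L R'"
      have Q: "Q \<in> isometry_group sX"
        unfolding Q_def by (intro isometry_compose R R' T)
      have "Q - id_blinfun = R o\<^sub>L (T - id_blinfun) o\<^sub>L R'"
        by (rule blinfun_eqI) (simp add: Q_def blinfun.diff_left blinfun.diff_right RR')
      then have "norm (Q - id_blinfun) \<le> norm (R o\<^sub>L (T - id_blinfun)) * norm R'"
        by (metis norm_blinfun_compose)
      also have "\<dots> \<le> norm (T - id_blinfun)"
        using norm_blinfun_compose[of R "T - id_blinfun"]
        by (simp add: isometry_norm[OF R(1) x0] isometry_norm[OF R'(1) x0])
      finally have "norm (Q - id_blinfun) < \<epsilon>" using T(3) by simp
      moreover have "blinfun_apply Q x = y"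
        using R'R[of x0] R(2) T(2) RR' by (simp add: Q_def)
      ultimately show ?thesis
        using Q isometry_norm[OF Q x0] by (auto simp: isometry_group_def)
    qed
    then show ?thesis using \<delta>(1) by blast
  qed
  then show ?thesis
    unfolding uniformly_micro_semitransitive_def by (simp add: Ball_def) metis
qed

section \<open>From the Bishop-Phelps-Bollobas property to its pointwise form\<close>

lemma BPB_imp_pointwise_BPB:
  assumes "uniformly_micro_semitransitive sX" "BPB_property sX sY"
  shows "pointwise_BPB_property sX sY"
  unfolding pointwise_BPB_property_def
proof (intro allI impI)
  fix \<epsilon> :: real assume "\<epsilon> > 0"
  obtain \<beta> :: "real \<Rightarrow> real" where \<beta>: "\<And>\<epsilon>. \<epsilon> \<in> {0<..<2} \<Longrightarrow> \<beta> \<epsilon> > 0"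
    "\<And>\<epsilon> x y. \<epsilon> \<in> {0<..<2} \<Longrightarrow> x \<in> sphere 0 1 \<Longrightarrow> y \<in> sphere 0 1 \<Longrightarrow> norm (x - y) < \<beta> \<epsilon> \<Longrightarrow>
       \<exists>T \<in> bounded_ops sX sX. norm T = 1 \<and> blinfun_apply T x = y \<and> norm (T - id_blinfun) < \<epsilon>"
    using assms(1) unfolding uniformly_micro_semitransitive_def by metis
  \<comment> \<open>The minimum with 1 keeps \<open>e\<close> in the domain (0,2) of
    \<open>\<beta>\<close>, since \<open>\<epsilon>\<close> may be large.\<close>
  define e where "e = min (\<epsilon>/2) 1"
  have e: "e \<in> {0<..<2}" "e \<le> \<epsilon>/2" using \<open>\<epsilon> > 0\<close> by (auto simp: e_def)
  \<comment> \<open>\<open>\<epsilon>/2\<close> bounds the distance from \<open>S\<close> to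
    \<open>T\<close>; \<open>\<beta> e\<close> brings \<open>x\<close> close enough to
    \<open>x0\<close> for an operator within \<open>e\<close> of the identity to take
    \<open>x0\<close> to \<open>x\<close>.\<close>
  define d where "d = min (\<epsilon>/2) (\<beta> e)"
  have "d > 0" using \<open>\<epsilon> > 0\<close> \<beta>(1)[OF e(1)] by (simp add: d_def)
  then obtain \<eta> where "\<eta> > 0" and \<eta>: "\<And>T x0. T \<in> bounded_ops sX sY \<Longrightarrow> x0 \<in> sphere 0 1 \<Longrightarrow>
      norm T = 1 \<Longrightarrow> norm (blinfun_apply T x0) > 1 - \<eta> \<Longrightarrow>
      \<exists>S \<in> bounded_ops sX sY. \<exists>x \<in> sphere 0 1.
        norm S = 1 \<and> norm (blinfun_apply S x) = 1 \<and> norm (x0 - x) < d \<and> norm (S - T) < d"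
    using assms(2) unfolding BPB_property_def by metis
  have "\<exists>S \<in> bounded_ops sX sY. norm S = 1 \<and> norm (blinfun_apply S x0) = 1 \<and> norm (S - T) < \<epsilon>"
    if T: "T \<in> bounded_ops sX sY" "norm T = 1" and x0: "x0 \<in> sphere 0 1"
      and Tx0: "norm (blinfun_apply T x0) > 1 - \<eta>" for T x0
  proof -
    obtain S x where S: "S \<in> bounded_ops sX sY" "norm S = 1" "norm (S - T) < d"
      and x: "x \<in> sphere 0 1" "norm (blinfun_apply S x) = 1" "norm (x0 - x) < d"
      using \<eta>[OF T(1) x0 T(2) Tx0] by blast
    obtain R where R: "R \<in> bounded_ops sX sX" "norm R = 1" "blinfun_apply R x0 = x"
      "norm (R - id_blinfun) < e"
      using \<beta>(2)[OF e(1) x0 x(1)] x(3) by (auto simp: d_def)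
    have at: "norm (blinfun_apply (S o\<^sub>L R) x0) = 1" by (simp add: R(3) x(2))
    \<comment> \<open>At most 1 by submultiplicativity, at least 1 because of the value at the unit
      vector \<open>x0\<close>.\<close>
    have "norm (S o\<^sub>L R) = 1"
      using norm_blinfun_compose[of S R] norm_blinfun[of "S o\<^sub>L R" x0] at x0 by (simp add: S(2) R(2))
    \<comment> \<open>Each summand has norm below \<open>\<epsilon>/2\<close>, the first because
      \<open>norm S = 1\<close>.\<close>
    moreover have "(S o\<^sub>L R) - T = (S o\<^sub>L (R - id_blinfun)) + (S - T)"
      by (rule blinfun_eqI) (simp add: blinfun.diff_left blinfun.add_left blinfun.diff_right)
    then have "norm ((S o\<^sub>L R) - T) \<le> norm (S o\<^sub>L (R - id_blinfun)) + norm (S - T)"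
      by (metis norm_triangle_ineq)
    then have "norm ((S o\<^sub>L R) - T) \<le> norm (R - id_blinfun) + norm (S - T)"
      using norm_blinfun_compose[of S "R - id_blinfun"] unfolding S(2) by linarith
    then have "norm ((S o\<^sub>L R) - T) < \<epsilon>"
      using S(3) R(4) e(2) by (simp add: d_def)
    ultimately show ?thesis using at bounded_ops_compose[OF S(1) R(1)] by blast
  qed
  then show "\<exists>\<eta>>0. \<forall>T \<in> bounded_ops sX sY. \<forall>x0 \<in> sphere 0 1.
      norm T = 1 \<and> norm (blinfun_apply T x0) > 1 - \<eta> \<longrightarrow>
      (\<exists>S \<in> bounded_ops sX sY. norm S = 1 \<and> norm (blinfun_apply S x0) = 1 \<and> norm (S - T) < \<epsilon>)"
    using \<open>\<eta> > 0\<close> by blast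
qed

text \<open>The second conjunct expresses that the micro-transitive case is covered by the
  first.\<close>

theorem proposition2p12:
  fixes sX :: "'k::real_normed_field \<Rightarrow> 'a::banach \<Rightarrow> 'a"
    and sY :: "'k \<Rightarrow> 'b::banach \<Rightarrow> 'b"
  assumes "banach_over sX" and "banach_over sY"
  shows "(uniformly_micro_semitransitive sX \<and> BPB_property sX sY \<longrightarrow> pointwise_BPB_property sX sY) \<and>
         (micro_transitive sX \<longrightarrow> uniformly_micro_semitransitive sX)"
  using BPB_imp_pointwise_BPB micro_transitive_imp_uniformly_micro_semitransitive[OF assms(1)]
  by blast

end
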